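(* Let $L\ge 2$, $V\ge 1$, $W\ge 1$ be integers, let $n\ge L$, and let $a=(a_0,\dots,a_{n-1})\in\mathbb{Z}_{\ge 0}^n$. For $r\in\{0,\dots,L-1\}$ let $\Sigma_r=\sum_{0\le c\le n-1,\ c\equiv r\ (\mathrm{mod}\ L)}a_c$, and for $\tau\in\mathbb{Z}/V$ let $F_r^{\min}(\tau)$ be the least integer $F_r\ge0$ with $\Sigma_r-\tau\equiv W F_r\pmod V$ (and $\infty$ if there is none). Then the algorithm ResidueBound on input $(a,L,V,W)$ returns $$\hat K=\min_{\tau\in\mathbb{Z}/V}\ \sum_{r=0}^{L-1}F_r^{\min}(\tau).$$ Moreover $\hat K\le K^\star$, where $K^\star$ is the optimum of the $(L,V,W)$ block-cover problem for $a$.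
   Context: Block-cover problem. Fix integers $L\ge2$, $V,W\ge1$ and a profile $a=(a_0,\dots,a_{n-1})\in\mathbb{Z}_{\ge0}^n$. A tiling (feasible solution) consists of nonnegative integers $t_c$ for $0\le c\le n-L$ (number of horizontal blocks of length $L$ whose leftmost cell is column $c$; set $t_c=0$ for all other integers $c$), and nonnegative integers $s_c,f_c$ for $0\le c\le n-1$ (numbers of vertical blocks of value $V$, and of $W$-blocks of value $W$, at column $c$), such that $$a_c=T_c+V s_c+W f_c\quad\text{for all }0\le c\le n-1,\qquad T_c=\sum_{j=0}^{L-1}t_{c-j}.$$ The optimum is $K^\star=\min\sum_{c=0}^{n-1} f_c$ over all tilings, with $K^\star=\infty$ if there is no tiling. Algorithm ResidueBound$(a,L,V,W)$. Set $y\gets a$. For $i=0,1,\dots,n-L-1$ in this order, replace $y[i+L]$ by $y[i+L]+y[i]$. Let $\sigma=(V-W)\bmod V$. For each $c\in\{1,\dots,L\}$ and each residue $r\in\{0,\dots,V-1\}$, let $\mathrm{reach}_c[r]$ be the least $m\in\{0,\dots,V-1\}$ with $(y[n-c]+\sigma m)\bmod V=r$, and $\mathrm{reach}_c[r]=\infty$ if there is none. The output is $\hat K=\min_{0\le r\le V-1}\sum_{c=1}^{L}\mathrm{reach}_c[r]$. *)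

theory Defs
  imports "HOL-Library.Extended_Nat" "HOL-Number_Theory.Cong"
begin

text \<open>A profile \<open>(a\<^sub>0, \<dots>, a\<^bsub>n-1\<^esub>)\<close> is the list \<open>a\<close> with \<open>n = length a\<close>.\<close>

definition least_or_infinity :: "(nat \<Rightarrow> bool) \<Rightarrow> enat" where
  "least_or_infinity P = (if \<exists>m. P m then enat (LEAST m. P m) else \<infinity>)"

text \<open>\<open>t\<close> is indexed by all integers, so that \<open>t (c - j)\<close> is not truncated for \<open>j > c\<close>.\<close>

definition is_tiling ::
  "nat \<Rightarrow> nat \<Rightarrow> nat \<Rightarrow> nat list \<Rightarrow> (int \<Rightarrow> nat) \<Rightarrow> (nat \<Rightarrow> nat) \<Rightarrow> (nat \<Rightarrow> nat) \<Rightarrow> bool" where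
  "is_tiling L V W a t s f \<longleftrightarrow>
     (\<forall>c. \<not> (0 \<le> c \<and> c \<le> int (length a) - int L) \<longrightarrow> t c = 0) \<and>
     (\<forall>c<length a. a ! c = (\<Sum>j<L. t (int c - int j)) + V * s c + W * f c)"

definition block_cover_opt :: "nat \<Rightarrow> nat \<Rightarrow> nat \<Rightarrow> nat list \<Rightarrow> enat" where
  "block_cover_opt L V W a =
     least_or_infinity (\<lambda>k. \<exists>t s f. is_tiling L V W a t s f \<and> k = (\<Sum>c<length a. f c))"

definition accumulate :: "nat \<Rightarrow> nat list \<Rightarrow> nat list" where
  "accumulate L a = fold (\<lambda>i y. y[i + L := y ! (i + L) + y ! i]) [0..<length a - L] a"

definition reach :: "nat \<Rightarrow> nat \<Rightarrow> nat \<Rightarrow> nat \<Rightarrow> enat" where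
  "reach V W z r =
     (let \<sigma> = (int V - int W) mod int V
      in least_or_infinity (\<lambda>m. m < V \<and> (int z + \<sigma> * int m) mod int V = int r))"

definition residue_bound :: "nat list \<Rightarrow> nat \<Rightarrow> nat \<Rightarrow> nat \<Rightarrow> enat" where
  "residue_bound a L V W =
     (let y = accumulate L a
      in MIN r\<in>{..<V}. \<Sum>c=1..L. reach V W (y ! (length a - c)) r)"

definition class_sum :: "nat \<Rightarrow> nat list \<Rightarrow> nat \<Rightarrow> nat" where
  "class_sum L a r = (\<Sum>c | c < length a \<and> [c = r] (mod L). a ! c)"

text \<open>The element \<open>\<tau>\<close> of \<open>\<int>/V\<close> is given by an integer representative; the value depends only on
  its residue class.\<close>

definition F_min :: "nat \<Rightarrow> nat \<Rightarrow> nat \<Rightarrow> nat list \<Rightarrow> nat \<Rightarrow> int \<Rightarrow> enat" where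
  "F_min L V W a r \<tau> =
     least_or_infinity (\<lambda>F. [int (class_sum L a r) - \<tau> = int W * int F] (mod int V))"

end

theory Submission
  imports Defs
begin

text \<open>After the loop, each of the last \<open>L\<close> entries of \<open>y\<close> carries the sum of its residue class
  modulo \<open>L\<close>. Since \<open>\<sigma> \<equiv> - W\<close>, reaching \<open>r\<close> from \<open>z\<close> in \<open>m\<close> steps means \<open>z - r \<equiv> W m\<close> modulo \<open>V\<close>.
  For the lower bound, every horizontal block covers each residue class exactly once, so in a tiling
  all class sums are congruent modulo \<open>V\<close>, up to \<open>W\<close> times the number of \<open>W\<close>-blocks in the class, to
  the total number of horizontal blocks.\<close>

section \<open>Least elements\<close>

lemma least_or_infinity_le: "P m \<Longrightarrow> least_or_infinity P \<le> enat m"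
  by (auto simp: least_or_infinity_def intro: Least_le)

text \<open>The least \<open>Q\<close>-element dominates some \<open>P\<close>-element, which
  satisfies \<open>Q\<close> too and hence equals it. This serves to compare a bounded search with
  an unbounded one.\<close>

lemma least_or_infinity_cofinal:
  assumes "\<And>m. P m \<Longrightarrow> Q m" and "\<And>m. Q m \<Longrightarrow> \<exists>m'\<le>m. P m'"
  shows "least_or_infinity P = least_or_infinity Q"
proof (cases "\<exists>m. Q m")
  case True
  then have Q: "Q (LEAST m. Q m)"
    by (meson LeastI_ex)
  then obtain m where m: "m \<le> (LEAST m. Q m)" "P m"
    using assms(2) by blast
  then have "m = (LEAST m. Q m)"
    using assms(1) Least_le[of Q m] by force
  then have "(LEAST m. P m) = (LEAST m. Q m)"
    using m assms(1) by (intro Least_equality) (auto intro: Least_le)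
  with m True show ?thesis
    by (auto simp: least_or_infinity_def)
next
  case False
  with assms(1) show ?thesis
    by (auto simp: least_or_infinity_def)
qed

section \<open>The accumulation loop\<close>

text \<open>Closed form of entry \<open>i\<close> once the loop has finished updating it.\<close>

definition partial_class_sum :: "nat \<Rightarrow> nat list \<Rightarrow> nat \<Rightarrow> nat" where
  "partial_class_sum L a i = (\<Sum>c | c \<le> i \<and> [c = i] (mod L). a ! c)"

lemma partial_class_sum_less:
  assumes "i < L"
  shows "partial_class_sum L a i = a ! i"
proof -
  have "{c. c \<le> i \<and> [c = i] (mod L)} = {i}"
    using assms by (auto simp: cong_def)
  then show ?thesis
    by (simp add: partial_class_sum_def)
qed

text \<open>Mirrors one assignment of the loop: no index strictly between \<open>i\<close> and
  \<open>i + L\<close> lies in the class of \<open>i\<close>.\<close>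

lemma partial_class_sum_step:
  assumes "L > 0"
  shows "partial_class_sum L a (i + L) = a ! (i + L) + partial_class_sum L a i"
proof -
  have "c \<le> i" if "c \<le> i + L" "[c = i + L] (mod L)" "c \<noteq> i + L" for c
  proof (rule ccontr)
    assume "\<not> c \<le> i"
    moreover have "[i + L = c] (mod L)"
      using that(2) by (rule cong_sym)
    then have "L dvd i + L - c"
      using that(1) by (simp add: cong_altdef_nat)
    ultimately show False
      using that nat_dvd_not_less[of "i + L - c" L] by linarith
  qed
  then have "{c. c \<le> i + L \<and> [c = i + L] (mod L)} = insert (i + L) {c. c \<le> i \<and> [c = i] (mod L)}"
    by (auto simp: cong_def)
  then show ?thesis
    using assms by (simp add: partial_class_sum_def)
qed

text \<open>Loop invariant after \<open>k\<close> iterations. As \<open>L > 0\<close>, entry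
  \<open>k\<close> is already final when iteration \<open>k\<close> reads it to update entry
  \<open>k + L\<close>.\<close>

lemma accumulate_prefix:
  assumes "L > 0" and "k + L \<le> length a"
  defines "y \<equiv> fold (\<lambda>i y. y[i + L := y ! (i + L) + y ! i]) [0..<k] a"
  shows "length y = length a \<and>
    (\<forall>i<length a. y ! i = (if i < k + L then partial_class_sum L a i else a ! i))"
  using assms(2) unfolding y_def
proof (induction k)
  case 0
  then show ?case by (simp add: partial_class_sum_less)
next
  case (Suc k)
  then show ?case
    using \<open>L > 0\<close> partial_class_sum_step[OF \<open>L > 0\<close>, of a k]
    by (auto simp: nth_list_update less_Suc_eq)
qed

lemma accumulate_nth:
  assumes "L > 0" and "L \<le> length a" and "i < length a"
  shows "accumulate L a ! i = partial_class_sum L a i"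
  using accumulate_prefix[of L "length a - L" a] assms by (simp add: accumulate_def)

text \<open>From one of the last \<open>L\<close> positions, the next index of the same class falls
  beyond the end, so the partial sum is already complete.\<close>

lemma accumulate_last:
  assumes "1 \<le> c" and "c \<le> L" and "L \<le> length a"
  shows "accumulate L a ! (length a - c) = class_sum L a (length a - c)"
proof -
  have "d \<le> length a - c" if "d < length a" "[d = length a - c] (mod L)" for d
  proof (rule ccontr)
    assume less: "\<not> d \<le> length a - c"
    then have "L dvd d - (length a - c)"
      using that(2) by (simp add: cong_altdef_nat)
    then show False
      using that(1) less assms nat_dvd_not_less[of "d - (length a - c)" L] by linarith
  qed
  then have "{d. d \<le> length a - c \<and> [d = length a - c] (mod L)} =
      {d. d < length a \<and> [d = length a - c] (mod L)}"
    using assms by auto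
  then show ?thesis
    using assms by (simp add: accumulate_nth partial_class_sum_def class_sum_def)
qed

section \<open>The algorithm computes the class formula\<close>

text \<open>Whether \<open>m\<close> is a solution depends only on \<open>m mod V\<close>, which is
  at most \<open>m\<close>; so the least solution, if any, lies below \<open>V\<close>.\<close>

lemma reach_eq:
  assumes "r < V"
  shows "reach V W z r = least_or_infinity (\<lambda>m. [int z - int r = int W * int m] (mod int V))"
proof -
  have iff: "(int z + (int V - int W) mod int V * int m) mod int V = int r \<longleftrightarrow>
      [int z - int r = int W * int m] (mod int V)" for m
  proof -
    have "(int z + (int V - int W) mod int V * int m) mod int V =
        (int z + (int V - int W) * int m) mod int V"
      by (intro mod_add_cong mod_mult_cong) simp_all
    then have "(int z + (int V - int W) mod int V * int m) mod int V = int r \<longleftrightarrow>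
        [int z + (int V - int W) * int m = int r] (mod int V)"
      using assms by (simp add: cong_def)
    \<comment> \<open>Expanding \<open>(V - W) * m\<close> isolates the multiple
      \<open>V * m\<close>, which divisibility by \<open>V\<close> ignores.\<close>
    also have "\<dots> \<longleftrightarrow> int V dvd (int z - int r - int W * int m) + int V * int m"
      by (simp add: cong_iff_dvd_diff algebra_simps)
    also have "\<dots> \<longleftrightarrow> [int z - int r = int W * int m] (mod int V)"
      by (simp only: cong_iff_dvd_diff dvd_add_left_iff[OF dvd_triv_left])
    finally show ?thesis .
  qed
  have "\<exists>m'\<le>m. m' < V \<and> [int z - int r = int W * int m'] (mod int V)"
    if "[int z - int r = int W * int m] (mod int V)" for m
  proof (intro exI[of _ "m mod V"] conjI)
    show "[int z - int r = int W * int (m mod V)] (mod int V)"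
      using that by (simp add: cong_def mod_simps zmod_int)
  qed (use assms in auto)
  then show ?thesis
    unfolding reach_def Let_def iff by (intro least_or_infinity_cofinal) auto
qed

lemma F_min_mod: "F_min L V W a (r mod L) \<tau> = F_min L V W a r \<tau>"
  by (simp add: F_min_def class_sum_def)

text \<open>Two of these positions differ by less than \<open>L\<close>, which gives injectivity;
  equal cardinalities then give surjectivity.\<close>

lemma bij_betw_last_residues:
  assumes "L \<le> (n::nat)"
  shows "bij_betw (\<lambda>c. (n - c) mod L) {1..L} {..<L}"
proof -
  have le: "c = d" if "c \<le> d" "1 \<le> c" "d \<le> L" "(n - c) mod L = (n - d) mod L" for c d
  proof (rule ccontr)
    assume "c \<noteq> d"
    have "L dvd (n - c) - (n - d)"
      using that assms mod_eq_dvd_iff_nat[of "n - d" "n - c" L] by simp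
    then show False
      using that assms \<open>c \<noteq> d\<close> nat_dvd_not_less[of "(n - c) - (n - d)" L] by linarith
  qed
  have "inj_on (\<lambda>c. (n - c) mod L) {1..L}"
    by (rule inj_onI) (metis atLeastAtMost_iff le nat_le_linear)
  moreover have "(\<lambda>c. (n - c) mod L) ` {1..L} \<subseteq> {..<L}"
    by auto
  ultimately show ?thesis
    unfolding bij_betw_def by (intro conjI card_subset_eq) (simp_all add: card_image)
qed

text \<open>The target residue \<open>r\<close> of the algorithm plays the part of \<tau>. For fixed
  \<open>r\<close> the sums agree term by term once the last \<open>L\<close> columns are reindexed
  by their classes.\<close>

lemma residue_bound_eq:
  assumes "L \<le> length a"
  shows "residue_bound a L V W = (MIN \<tau>\<in>{0..<int V}. \<Sum>r<L. F_min L V W a r \<tau>)"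
proof -
  have "(\<Sum>c=1..L. reach V W (accumulate L a ! (length a - c)) r) =
      (\<Sum>i<L. F_min L V W a i (int r))" if "r < V" for r
  proof -
    have "(\<Sum>c=1..L. reach V W (accumulate L a ! (length a - c)) r) =
        (\<Sum>c=1..L. F_min L V W a ((length a - c) mod L) (int r))"
      unfolding F_min_mod using assms \<open>r < V\<close>
      by (intro sum.cong) (auto simp: accumulate_last reach_eq F_min_def)
    also have "\<dots> = (\<Sum>i<L. F_min L V W a i (int r))"
      by (rule sum.reindex_bij_betw[OF bij_betw_last_residues[OF assms]])
    finally show ?thesis .
  qed
  moreover have "{0..<int V} = int ` {..<V}"
    by (simp add: image_int_atLeastLessThan lessThan_atLeast0)
  ultimately show ?thesis
    by (auto simp: residue_bound_def image_image intro!: arg_cong[of _ _ Min])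
qed

section \<open>Tilings\<close>

lemma card_residue_window:
  assumes "r < (L::nat)"
  shows "card {c \<in> {k..<k + L}. [c = r] (mod L)} = 1"
proof -
  \<comment> \<open>Reversal turns the window into the last \<open>L\<close> positions of a profile
    of length \<open>k + L\<close>.\<close>
  have "bij_betw (\<lambda>c. k + L - c) {1..L} {k..<k + L}"
    by (rule bij_betw_byWitness[where f' = "\<lambda>c. k + L - c"]) auto
  moreover have "bij_betw ((\<lambda>c. c mod L) \<circ> (\<lambda>c. k + L - c)) {1..L} {..<L}"
    using bij_betw_last_residues[of L "k + L"] by (simp add: comp_def)
  ultimately have "bij_betw (\<lambda>c. c mod L) {k..<k + L} {..<L}"
    using bij_betw_comp_iff by blast
  then have *: "bij_betw (\<lambda>c. c mod L) {c \<in> {k..<k + L}. [c = r] (mod L)} {i \<in> {..<L}. i = r}"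
    using assms by (intro bij_betw_Collect) (simp_all add: cong_def)
  have "{i \<in> {..<L}. i = r} = {r}"
    using assms by auto
  then show ?thesis
    using bij_betw_same_card[OF *] by (simp only: card.empty card.insert finite.emptyI) simp
qed

text \<open>Double counting: a block starting at \<open>k\<close> covers the window
  \<open>{k..<k + L}\<close>, which meets the class in exactly one cell.\<close>

lemma class_sum_horizontal:
  fixes t :: "int \<Rightarrow> nat"
  assumes "r < L" and "L \<le> n" and t: "\<And>c. \<not> (0 \<le> c \<and> c \<le> int n - int L) \<Longrightarrow> t c = 0"
  shows "(\<Sum>c | c < n \<and> [c = r] (mod L). \<Sum>j<L. t (int c - int j)) = (\<Sum>k\<le>n - L. t (int k))"
proof -
  define C where "C = {c. c < n \<and> [c = r] (mod L)}"
  have inner: "(\<Sum>j<L. t (int c - int j)) = (\<Sum>k\<le>n - L. if c \<in> {k..<k + L} then t (int k) else 0)"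
    for c
  proof -
    \<comment> \<open>The dropped terms vanish, since their blocks would start left of column 0 or
      stick out on the right. On the others, subtraction in \<open>nat\<close> is exact.\<close>
    have "(\<Sum>j<L. t (int c - int j)) = (\<Sum>j | j < L \<and> j \<le> c \<and> c - j \<le> n - L. t (int c - int j))"
      using assms(2) by (intro sum.mono_neutral_right) (auto intro!: t)
    also have "\<dots> = (\<Sum>k | k \<le> n - L \<and> c \<in> {k..<k + L}. t (int k))"
      by (rule sum.reindex_bij_witness[where i = "\<lambda>k. c - k" and j = "\<lambda>j. c - j"])
        (auto simp: of_nat_diff)
    also have "\<dots> = (\<Sum>k\<le>n - L. if c \<in> {k..<k + L} then t (int k) else 0)"
      by (rule sum.mono_neutral_cong_left) auto
    finally show ?thesis .
  qed
  have "(\<Sum>c\<in>C. \<Sum>j<L. t (int c - int j)) =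
      (\<Sum>k\<le>n - L. \<Sum>c\<in>C. if c \<in> {k..<k + L} then t (int k) else 0)"
    unfolding inner by (rule sum.swap)
  also have "\<dots> = (\<Sum>k\<le>n - L. t (int k))"
  proof (rule sum.cong[OF refl])
    fix k assume "k \<in> {..n - L}"
    \<comment> \<open>Since \<open>k \<le> n - L\<close>, the whole window lies inside the
      profile.\<close>
    then have "C \<inter> {k..<k + L} = {c \<in> {k..<k + L}. [c = r] (mod L)}"
      using assms(2) by (auto simp: C_def)
    then have "card (C \<inter> {k..<k + L}) = 1"
      using card_residue_window[OF assms(1)] by simp
    moreover have "finite C"
      by (simp add: C_def)
    ultimately show "(\<Sum>c\<in>C. if c \<in> {k..<k + L} then t (int k) else 0) = t (int k)"
      by (simp only: sum.inter_restrict[symmetric] sum_constant) simp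
  qed
  finally show ?thesis
    by (simp add: C_def)
qed

lemma sum_residue_classes:
  assumes "L > (0::nat)"
  shows "(\<Sum>r<L. \<Sum>c | c < n \<and> [c = r] (mod L). f c) = (\<Sum>c<n. f c :: nat)"
proof -
  have "(\<Sum>r<L. \<Sum>c | c < n \<and> [c = r] (mod L). f c) = (\<Sum>r<L. \<Sum>c | c \<in> {..<n} \<and> c mod L = r. f c)"
    by (intro sum.cong) (auto simp: cong_def)
  also have "\<dots> = (\<Sum>c<n. f c)"
    using assms by (intro sum.group) auto
  finally show ?thesis .
qed

text \<open>The number of \<open>W\<close>-blocks in the class is itself a candidate for the
  minimum: modulo \<open>V\<close> the vertical blocks vanish and the horizontal ones contribute
  \<tau>.\<close>

lemma F_min_le_tiling:
  assumes "is_tiling L V W a t s f" and "r < L" and "L \<le> length a"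
    and \<tau>: "[\<tau> = int (\<Sum>k\<le>length a - L. t (int k))] (mod int V)"
  shows "F_min L V W a r \<tau> \<le> enat (\<Sum>c | c < length a \<and> [c = r] (mod L). f c)"
proof -
  define C where "C = {c. c < length a \<and> [c = r] (mod L)}"
  define T where "T = (\<Sum>k\<le>length a - L. t (int k))"
  have "class_sum L a r = (\<Sum>c\<in>C. (\<Sum>j<L. t (int c - int j)) + V * s c + W * f c)"
    unfolding class_sum_def C_def
    using assms(1) by (intro sum.cong) (auto simp: is_tiling_def)
  also have "\<dots> = T + V * sum s C + W * sum f C"
    using class_sum_horizontal[OF assms(2,3), of t] assms(1)
    by (simp add: C_def T_def sum.distrib sum_distrib_left is_tiling_def)
  finally have sum: "int (class_sum L a r) = int T + int V * int (sum s C) + int W * int (sum f C)"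
    by simp
  have "int V dvd \<tau> - int T"
    using \<tau> by (simp add: T_def cong_iff_dvd_diff)
  then have "int V dvd int V * int (sum s C) - (\<tau> - int T)"
    by simp
  moreover have "int (class_sum L a r) - \<tau> - int W * int (sum f C) =
      int V * int (sum s C) - (\<tau> - int T)"
    using sum by linarith
  ultimately have "[int (class_sum L a r) - \<tau> = int W * int (sum f C)] (mod int V)"
    by (simp only: cong_iff_dvd_diff)
  then show ?thesis
    unfolding F_min_def C_def by (rule least_or_infinity_le)
qed

lemma F_min_bound_le_tiling:
  assumes "is_tiling L V W a t s f" and "L > 0" and "V > 0" and "L \<le> length a"
  shows "(MIN \<tau>\<in>{0..<int V}. \<Sum>r<L. F_min L V W a r \<tau>) \<le> enat (\<Sum>c<length a. f c)"
proof -
  \<comment> \<open>The total number of horizontal blocks does not depend on the class, so one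
    \<tau> serves all \<open>r\<close>; reducing it modulo \<open>V\<close> puts it in the range of
    the minimum.\<close>
  define \<tau> where "\<tau> = int (\<Sum>k\<le>length a - L. t (int k)) mod int V"
  have "(\<Sum>r<L. F_min L V W a r \<tau>) \<le> (\<Sum>r<L. enat (\<Sum>c | c < length a \<and> [c = r] (mod L). f c))"
    by (intro sum_mono F_min_le_tiling[OF assms(1)]) (use assms(4) in \<open>auto simp: \<tau>_def cong_def\<close>)
  also have "\<dots> = enat (\<Sum>c<length a. f c)"
    using sum_residue_classes[OF assms(2), of f "length a"] by (simp flip: of_nat_eq_enat of_nat_sum)
  finally show ?thesis
    using assms(3) by (intro order_trans[OF Min_le]) (auto simp: \<tau>_def)
qed

theorem proposition1:
  fixes L V W n :: nat and a :: "nat list"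
  assumes "L \<ge> 2" and "V \<ge> 1" and "W \<ge> 1" and "n \<ge> L" and "length a = n"
  shows "residue_bound a L V W = (MIN \<tau>\<in>{0..<int V}. \<Sum>r<L. F_min L V W a r \<tau>) \<and>
         residue_bound a L V W \<le> block_cover_opt L V W a"
proof
  show eq: "residue_bound a L V W = (MIN \<tau>\<in>{0..<int V}. \<Sum>r<L. F_min L V W a r \<tau>)"
    using assms by (intro residue_bound_eq) simp
  define P where "P = (\<lambda>k. \<exists>t s f. is_tiling L V W a t s f \<and> k = (\<Sum>c<length a. f c))"
  have le: "residue_bound a L V W \<le> enat k" if "P k" for k
    using that F_min_bound_le_tiling[of L V W a] assms unfolding eq P_def by fastforce
  \<comment> \<open>If a tiling exists, the least value is attained by one and \<open>le\<close>
    applies; otherwise the right-hand side is infinite.\<close>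
  have "residue_bound a L V W \<le> least_or_infinity P"
    unfolding least_or_infinity_def by (auto intro: le LeastI)
  then show "residue_bound a L V W \<le> block_cover_opt L V W a"
    by (simp add: block_cover_opt_def P_def)
qed

end
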